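(* Let $V$ be a nonempty finite set and let $B \subseteq \mathbb{Z}^V$ be a nonempty set. The following three conditions are equivalent. (a) $B$ is BS-convex, i.e., $B = \mathrm{P}(f) \cap \mathbb{Z}^V$ for some integral bisubmodular function $f : \{-1,0,1\}^V \to \mathbb{Z} \cup \{+\infty\}$ with $f(\mathbf{0}) = 0$. (b) $B$ satisfies ($\Delta$-EXC): for any $p, q \in B$ and any $u \in \operatorname{supp}(q-p)$, there exists $\alpha \in \Phi_B(p,q)$ with $u \in \operatorname{supp}(\alpha)$. (c) $B$ satisfies (BS-EXC): for any $p, q \in B$, there exist $\alpha_1, \dots, \alpha_k \in \Phi_B(p,q)$ (not necessarily distinct, $k \ge 0$) such that $p + \sum_{i=1}^k \alpha_i/2 = q$.
   Context: For $t \in \mathbb{R}^V$, $\operatorname{supp}(t) = \{u \in V : t(u) \neq 0\}$; $\|p\|_1 = \sum_{u \in V}|p(u)|$; $\chi_u$ is the $u$-th unit vector; $\langle p, x\rangle = \sum_{u} p(u)x(u)$. Let $\Phi = \{\pm \chi_u : u \in V\} \cup \{\pm\chi_u \pm \chi_v : u, v \in V, u \ne v\}$ (the vectors in $\{-1,0,1\}^V$ of 1-norm 1 or 2). For $p, q \in \mathbb{Z}^V$, $\Phi(p,q) = \{\alpha \in \Phi : \|q - (p+\alpha)\|_1 = \|q-p\|_1 - \|\alpha\|_1\}$, and for $B \subseteq \mathbb{Z}^V$ and $p,q \in B$, $\Phi_B(p,q) = \{\alpha \in \Phi(p,q) : p + \alpha \in B\}$. For $x, y \in \{-1,0,1\}^V$,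 define coordinatewise $(x \sqcap y)(u) = x(u)$ if $x(u)=y(u)$ and $0$ otherwise; $(x \sqcup y)(u) = x(u)$ if $x(u)=y(u)$ or $y(u)=0$, $= y(u)$ if $x(u)=0$, and $=0$ if $0 \ne x(u) \ne y(u) \ne 0$. A function $f : \{-1,0,1\}^V \to \mathbb{R}\cup\{+\infty\}$ with $f(\mathbf{0})=0$ is bisubmodular if $f(x)+f(y) \ge f(x\sqcap y) + f(x \sqcup y)$ for all $x,y$; it is integral if all its finite values are integers. Its bisubmodular polyhedron is $\mathrm{P}(f) = \{p \in \mathbb{R}^V : \langle p, x\rangle \le f(x) \ \forall x \in \{-1,0,1\}^V\}$. *)

theory Defs
  imports Complex_Main "HOL-Library.Extended_Real"
begin

text \<open>The ground set V is the (nonempty, finite) universe of a type 'v :: finite.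
  Integer vectors in Z^V are functions 'v \<Rightarrow> int.\<close>

definition supp :: "('v \<Rightarrow> int) \<Rightarrow> 'v set" where
  "supp t = {u. t u \<noteq> 0}"

definition norm1 :: "('v::finite \<Rightarrow> int) \<Rightarrow> int" where
  "norm1 p = (\<Sum>u\<in>UNIV. \<bar>p u\<bar>)"

definition ip :: "('v::finite \<Rightarrow> int) \<Rightarrow> ('v \<Rightarrow> int) \<Rightarrow> int" where
  "ip p x = (\<Sum>u\<in>UNIV. p u * x u)"

definition signvecs :: "('v \<Rightarrow> int) set" where
  "signvecs = {x. \<forall>u. x u \<in> {-1, 0, 1}}"

definition Phi :: "('v::finite \<Rightarrow> int) set" where
  "Phi = {a. a \<in> signvecs \<and> (norm1 a = 1 \<or> norm1 a = 2)}"

definition Phi_pq :: "('v::finite \<Rightarrow> int) \<Rightarrow> ('v \<Rightarrow> int) \<Rightarrow> ('v \<Rightarrow> int) set" where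
  "Phi_pq p q = {a \<in> Phi. norm1 (\<lambda>u. q u - (p u + a u)) = norm1 (\<lambda>u. q u - p u) - norm1 a}"

definition Phi_B :: "('v::finite \<Rightarrow> int) set \<Rightarrow> ('v \<Rightarrow> int) \<Rightarrow> ('v \<Rightarrow> int) \<Rightarrow> ('v \<Rightarrow> int) set" where
  "Phi_B B p q = {a \<in> Phi_pq p q. (\<lambda>u. p u + a u) \<in> B}"

definition smeet :: "('v \<Rightarrow> int) \<Rightarrow> ('v \<Rightarrow> int) \<Rightarrow> ('v \<Rightarrow> int)" where
  "smeet x y = (\<lambda>u. if x u = y u then x u else 0)"

definition sjoin :: "('v \<Rightarrow> int) \<Rightarrow> ('v \<Rightarrow> int) \<Rightarrow> ('v \<Rightarrow> int)" where
  "sjoin x y = (\<lambda>u. if x u = y u \<or> y u = 0 then x u else if x u = 0 then y u else 0)"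

text \<open>Set functions on {-1,0,1}^V with values in R \<union> {+\<infinity>} are modelled as
  maps into ereal that never take the value -\<infinity> on sign vectors.\<close>

definition bisubmodular :: "(('v \<Rightarrow> int) \<Rightarrow> ereal) \<Rightarrow> bool" where
  "bisubmodular f \<longleftrightarrow> f (\<lambda>_. 0) = 0 \<and> (\<forall>x\<in>signvecs. f x \<noteq> -\<infinity>) \<and>
     (\<forall>x\<in>signvecs. \<forall>y\<in>signvecs. f x + f y \<ge> f (smeet x y) + f (sjoin x y))"

definition integral_fun :: "(('v \<Rightarrow> int) \<Rightarrow> ereal) \<Rightarrow> bool" where
  "integral_fun f \<longleftrightarrow> (\<forall>x\<in>signvecs. f x = \<infinity> \<or> (\<exists>n::int. f x = ereal (of_int n)))"

definition int_points_P :: "(('v::finite \<Rightarrow> int) \<Rightarrow> ereal) \<Rightarrow> ('v \<Rightarrow> int) set" where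
  "int_points_P f = {p. \<forall>x\<in>signvecs. ereal (of_int (ip p x)) \<le> f x}"

definition BS_convex :: "('v::finite \<Rightarrow> int) set \<Rightarrow> bool" where
  "BS_convex B \<longleftrightarrow> (\<exists>f. bisubmodular f \<and> integral_fun f \<and> B = int_points_P f)"

definition delta_exc :: "('v::finite \<Rightarrow> int) set \<Rightarrow> bool" where
  "delta_exc B \<longleftrightarrow> (\<forall>p\<in>B. \<forall>q\<in>B. \<forall>u\<in>supp (\<lambda>v. q v - p v).
      \<exists>a\<in>Phi_B B p q. u \<in> supp a)"

definition bs_exc :: "('v::finite \<Rightarrow> int) set \<Rightarrow> bool" where
  "bs_exc B \<longleftrightarrow> (\<forall>p\<in>B. \<forall>q\<in>B. \<exists>as. set as \<subseteq> Phi_B B p q \<and>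
      (\<forall>u. real_of_int (p u) + (\<Sum>a\<leftarrow>as. real_of_int (a u) / 2) = real_of_int (q u)))"

end

theory Submission
  imports Defs
begin

text \<open>
  (a) implies (b): if \<open>p + s \<chi>\<^sub>u\<close> leaves the polyhedron, the tight sign vectors with value \<open>s\<close> at \<open>u\<close> have
  a least element \<open>x\<^sub>0\<close>. As \<open>\<langle>q - p, x\<^sub>0\<rangle> \<le> 0\<close>, some \<open>v\<close> satisfies \<open>x\<^sub>0(v) (q(v) - p(v)) < 0\<close>, and by
  minimality of \<open>x\<^sub>0\<close> the step at \<open>u\<close> can be completed by the step at \<open>v\<close>.

  (b) implies (a): let \<open>f\<close> be the support function of \<open>B\<close> on sign vectors. For \<open>p, q \<in> B\<close>, exchanges
  produce a point of \<open>B\<close> at least as good as \<open>p\<close> for \<open>x \<sqinter> y\<close> and as \<open>q\<close> for \<open>x \<squnion> y\<close>, so \<open>f\<close> is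
  bisubmodular. If \<open>p + s \<chi>\<^sub>u \<notin> B\<close>, then the sign vector with value \<open>s\<close> at \<open>u\<close> and \<open>-t\<close> at each \<open>v\<close> with
  \<open>p + s \<chi>\<^sub>u + t \<chi>\<^sub>v \<in> B\<close> is maximised over \<open>B\<close> at \<open>p\<close>. Hence each step from \<open>p\<close> that stays in
  the polyhedron stays in \<open>B\<close>, and walking from \<open>B\<close> to an integer point of the polyhedron never leaves \<open>B\<close>.

  (b) implies (c): join the blocking sign vectors of the elements of a stable set \<open>W\<close> in the graph of
  feasible steps. This gives the Hall condition for a perfect matching in the bipartite double
  cover of that graph, where \<open>u\<close> has \<open>|q(u) - p(u)|\<close> clones on each side; the matching is the
  half-integral decomposition of \<open>q - p\<close>.
\<close>

subsection \<open>Steps and the exchange property\<close>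

text \<open>The vectors of \<open>Phi_pq p q\<close> are exactly the \<open>toward p q u v\<close> with \<open>u, v\<close> in the support of
  \<open>q - p\<close>; the case \<open>u = v\<close> gives the steps of norm 1.\<close>

definition toward :: "('v \<Rightarrow> int) \<Rightarrow> ('v \<Rightarrow> int) \<Rightarrow> 'v \<Rightarrow> 'v \<Rightarrow> 'v \<Rightarrow> int" where
  "toward p q u v = (\<lambda>w. if w = u \<or> w = v then sgn (q w - p w) else 0)"

lemma toward_in_Phi_pq:
  fixes p q :: "'v::finite \<Rightarrow> int"
  assumes "p u \<noteq> q u" "p v \<noteq> q v"
  shows "toward p q u v \<in> Phi_pq p q"
proof -
  have "norm1 (toward p q u v) = (\<Sum>w\<in>{u, v}. 1)"
    unfolding norm1_def
    by (rule sum.mono_neutral_cong_right) (use assms in \<open>auto simp: toward_def sgn_if\<close>)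
  then have 1: "norm1 (toward p q u v) = 1 \<or> norm1 (toward p q u v) = 2"
    by (auto simp: card_insert_if)
  have "norm1 (\<lambda>w. q w - (p w + toward p q u v w)) + norm1 (toward p q u v) = norm1 (\<lambda>w. q w - p w)"
    unfolding norm1_def sum.distrib[symmetric]
    by (rule sum.cong) (auto simp: toward_def sgn_if)
  with 1 show ?thesis
    by (auto simp: Phi_pq_def Phi_def signvecs_def toward_def sgn_if)
qed

lemma Phi_pq_cases:
  fixes p q :: "'v::finite \<Rightarrow> int"
  assumes "a \<in> Phi_pq p q"
  obtains u v where "p u \<noteq> q u" "p v \<noteq> q v" "a = toward p q u v"
proof -
  have a: "a \<in> signvecs" "norm1 a = 1 \<or> norm1 a = 2"
    and eq: "norm1 (\<lambda>w. q w - (p w + a w)) = norm1 (\<lambda>w. q w - p w) - norm1 a"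
    using assms by (auto simp: Phi_pq_def Phi_def)
  \<comment> \<open>Each summand is nonnegative by the triangle inequality, so the norm identity
    holds coordinate by coordinate.\<close>
  have "(\<Sum>w\<in>UNIV. \<bar>q w - (p w + a w)\<bar> + \<bar>a w\<bar> - \<bar>q w - p w\<bar>) = 0"
    using eq by (simp add: norm1_def sum.distrib sum_subtractf)
  then have "\<forall>w\<in>UNIV. \<bar>q w - (p w + a w)\<bar> + \<bar>a w\<bar> - \<bar>q w - p w\<bar> = 0"
    by (subst (asm) sum_nonneg_eq_0_iff) auto
  then have w: "a w = 0 \<or> (a w = sgn (q w - p w) \<and> p w \<noteq> q w)" for w
    using a(1) by (auto simp: signvecs_def sgn_if dest!: spec[of _ w]) 
  have "norm1 a = (\<Sum>w\<in>UNIV. if w \<in> supp a then 1 else 0)"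
    unfolding norm1_def
  proof (rule sum.cong)
    fix w show "\<bar>a w\<bar> = (if w \<in> supp a then 1 else 0)"
      using a(1) by (auto simp: supp_def signvecs_def dest!: spec[of _ w])
  qed simp
  also have "\<dots> = int (card (supp a))"
    by (subst sum.If_cases) auto
  finally have "card (supp a) = 1 \<or> card (supp a) = 2"
    using a(2) by auto
  then obtain u v where uv: "supp a = {u, v}"
    by (metis card_1_singletonE card_2_iff insert_absorb2)
  show ?thesis
  proof (rule that)
    show "p u \<noteq> q u" "p v \<noteq> q v"
      using w[of u] w[of v] uv by (auto simp: supp_def)
    show "a = toward p q u v"
    proof
      fix x show "a x = toward p q u v x"
        using w[of x] uv by (auto simp: supp_def toward_def set_eq_iff)
    qed
  qed
qed

text \<open>A form of \<open>delta_exc\<close> that names the second coordinate of the step;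
  \<open>v = u\<close> covers the unit steps.\<close>

definition exchange :: "('v \<Rightarrow> int) set \<Rightarrow> bool" where
  "exchange B \<longleftrightarrow> (\<forall>p\<in>B. \<forall>q\<in>B. \<forall>u. p u \<noteq> q u \<longrightarrow>
     (\<exists>v. p v \<noteq> q v \<and> (\<lambda>w. p w + toward p q u v w) \<in> B))"

lemma exchangeE:
  assumes "exchange B" "p \<in> B" "q \<in> B" "p u \<noteq> q u"
  obtains v where "p v \<noteq> q v" "(\<lambda>w. p w + toward p q u v w) \<in> B"
  using assms unfolding exchange_def by blast

lemma toward_commute: "toward p q u v = toward p q v u"
  by (auto simp: toward_def)

lemma delta_exc_iff_exchange:
  fixes B :: "('v::finite \<Rightarrow> int) set"
  shows "delta_exc B \<longleftrightarrow> exchange B"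
proof
  assume D: "delta_exc B"
  show "exchange B"
    unfolding exchange_def
  proof (intro ballI allI impI)
    fix p q u assume pq: "p \<in> B" "q \<in> B" "p u \<noteq> q u"
    then have "u \<in> supp (\<lambda>v. q v - p v)" by (simp add: supp_def)
    then obtain a where a: "a \<in> Phi_B B p q" "u \<in> supp a"
      using D pq unfolding delta_exc_def by blast
    then obtain x y where xy: "p x \<noteq> q x" "p y \<noteq> q y" "a = toward p q x y"
      by (auto simp: Phi_B_def elim: Phi_pq_cases)
    have "u = x \<or> u = y" using a(2) xy(3) by (auto simp: supp_def toward_def split: if_splits)
    then show "\<exists>v. p v \<noteq> q v \<and> (\<lambda>w. p w + toward p q u v w) \<in> B"
      using xy a(1) by (auto simp: Phi_B_def toward_commute)
  qed
next
  assume E: "exchange B"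
  show "delta_exc B"
    unfolding delta_exc_def
  proof (intro ballI)
    fix p q u assume pq: "p \<in> B" "q \<in> B" "u \<in> supp (\<lambda>v. q v - p v)"
    then have u: "p u \<noteq> q u" by (auto simp: supp_def)
    then obtain v where v: "p v \<noteq> q v" "(\<lambda>w. p w + toward p q u v w) \<in> B"
      using exchangeE[OF E] pq by metis
    have "toward p q u v \<in> Phi_B B p q"
      using toward_in_Phi_pq[OF u v(1)] v(2) by (simp add: Phi_B_def)
    moreover have "u \<in> supp (toward p q u v)"
      using u by (auto simp: supp_def toward_def sgn_if)
    ultimately show "\<exists>a\<in>Phi_B B p q. u \<in> supp a" by blast
  qed
qed

lemma ip_add: "ip (\<lambda>w. p w + a w) x = ip p x + ip a x"
  by (simp add: ip_def distrib_right sum.distrib)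

lemma ip_toward:
  fixes p q :: "'v::finite \<Rightarrow> int"
  shows "ip (toward p q u v) x =
    (if u = v then sgn (q u - p u) * x u else sgn (q u - p u) * x u + sgn (q v - p v) * x v)"
proof -
  have "ip (toward p q u v) x = (\<Sum>w\<in>{u, v}. sgn (q w - p w) * x w)"
    unfolding ip_def by (rule sum.mono_neutral_cong_right) (auto simp: toward_def)
  then show ?thesis by auto
qed

lemma ip_toward_ge:
  fixes p q :: "'v::finite \<Rightarrow> int"
  assumes "x u = sgn (q u - p u)" "p u \<noteq> q u" "x \<in> signvecs"
  shows "ip (toward p q u v) x \<ge> 0"
  using assms by (auto simp: ip_toward signvecs_def sgn_if dest!: spec[of _ v])

text \<open>Supplies the decreasing measure for all inductions that walk from one point towards
  another.\<close>

lemma dist_toward_less: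
  fixes p q :: "'v::finite \<Rightarrow> int"
  assumes "p u \<noteq> q u"
  shows "norm1 (\<lambda>w. q w - (p w + toward p q u v w)) < norm1 (\<lambda>w. q w - p w)"
  unfolding norm1_def
  by (rule sum_strict_mono_ex1) (use assms in \<open>auto simp: toward_def sgn_if intro!: exI[of _ u]\<close>)

lemma norm1_nonneg: "norm1 p \<ge> 0"
  by (simp add: norm1_def sum_nonneg)

lemma sgn_product_cases:
  fixes a b :: int
  assumes "a * b > 0" "a \<in> {-1, 0, 1}"
  shows "b \<noteq> 0" "a = sgn b"
  using assms by (auto simp: sgn_if)

text \<open>Moving \<open>q\<close> towards \<open>p\<close> at a coordinate where \<open>a\<close> improves cannot decrease \<open>b\<close>, because \<open>b\<close> gains
  one there and loses at most one at the second coordinate.\<close>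

lemma exchange_two_phase:
  fixes B :: "('v::finite \<Rightarrow> int) set"
  assumes E: "exchange B" and "p \<in> B" "q \<in> B"
    and sg: "a \<in> signvecs" "b \<in> signvecs" and le: "\<And>u. a u \<noteq> 0 \<Longrightarrow> b u = a u"
  obtains r where "r \<in> B" "ip p a \<le> ip r a" "ip q b \<le> ip r b"
proof -
  have "\<exists>r\<in>B. ip p a \<le> ip r a \<and> ip q b \<le> ip r b"
    using \<open>q \<in> B\<close>
  proof (induction "nat (norm1 (\<lambda>w. p w - q w))" arbitrary: q rule: less_induct)
    case less
    show ?case
    proof (cases "ip p a \<le> ip q a")
      case True
      then show ?thesis using less.prems by blast
    next
      case False
      then have "(\<Sum>u\<in>UNIV. a u * (p u - q u)) > 0"
        by (simp add: ip_def algebra_simps sum_subtractf)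
      then obtain u where u: "a u * (p u - q u) > 0"
        by (meson sum_nonpos not_le)
      moreover have "a u \<in> {-1, 0, 1}" using sg by (simp add: signvecs_def)
      ultimately have u': "p u - q u \<noteq> 0" "a u = sgn (p u - q u)"
        by (rule sgn_product_cases)+
      then have qu: "q u \<noteq> p u" by simp
      then obtain v where v: "(\<lambda>w. q w + toward q p u v w) \<in> B"
        using exchangeE[OF E less.prems \<open>p \<in> B\<close>] by metis
      let ?q = "\<lambda>w. q w + toward q p u v w"
      have "a u \<noteq> 0" using u by auto
      then have "b u = sgn (p u - q u)" using le u' by simp
      then have "ip q b \<le> ip ?q b"
        using ip_toward_ge[where p=q and q=p and u=u and x=b, OF _ qu sg(2)] by (simp add: ip_add)
      moreover have "nat (norm1 (\<lambda>w. p w - ?q w)) < nat (norm1 (\<lambda>w. p w - q w))"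
        using dist_toward_less[of q u p v, OF qu] norm1_nonneg[of "\<lambda>w. p w - ?q w"] by linarith
      then obtain r where "r \<in> B" "ip p a \<le> ip r a" "ip ?q b \<le> ip r b"
        using less.hyps[of ?q] v by blast
      ultimately show ?thesis by force
    qed
  qed
  then show ?thesis using that by blast
qed

lemma ip_smeet_sjoin:
  assumes "x \<in> signvecs" "y \<in> signvecs"
  shows "ip p (smeet x y) + ip p (sjoin x y) = ip p x + ip p y"
  unfolding ip_def sum.distrib[symmetric]
proof (rule sum.cong)
  fix u
  show "p u * smeet x y u + p u * sjoin x y u = p u * x u + p u * y u"
    using assms by (auto simp: signvecs_def smeet_def sjoin_def dest!: spec[of _ u])
qed simp

lemma smeet_signvecs [simp]: "x \<in> signvecs \<Longrightarrow> y \<in> signvecs \<Longrightarrow> smeet x y \<in> signvecs"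
  and sjoin_signvecs [simp]: "x \<in> signvecs \<Longrightarrow> y \<in> signvecs \<Longrightarrow> sjoin x y \<in> signvecs"
  by (auto simp: signvecs_def smeet_def sjoin_def)

lemma smeet_below_sjoin: "smeet x y u \<noteq> 0 \<Longrightarrow> sjoin x y u = smeet x y u"
  by (auto simp: smeet_def sjoin_def split: if_splits)

subsection \<open>Bisubmodular polyhedra have the exchange property\<close>

lemma bisubmodular_integer:
  assumes f: "bisubmodular f" "integral_fun f" and xy: "x \<in> signvecs" "y \<in> signvecs"
    and fx: "f x = ereal (of_int n)" and fy: "f y = ereal (of_int m)"
  obtains k l where "f (smeet x y) = ereal (of_int k)" "f (sjoin x y) = ereal (of_int l)" "k + l \<le> n + m"
proof -
  have le: "f (smeet x y) + f (sjoin x y) \<le> ereal (of_int (n + m))"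
    using f(1) xy fx fy unfolding bisubmodular_def by (metis of_int_add plus_ereal.simps(1))
  have "f (smeet x y) \<noteq> -\<infinity>" "f (sjoin x y) \<noteq> -\<infinity>"
    using f(1) xy unfolding bisubmodular_def by auto
  then have "f (smeet x y) \<noteq> \<infinity>" "f (sjoin x y) \<noteq> \<infinity>"
    using le by auto
  then obtain k l where kl: "f (smeet x y) = ereal (of_int k)" "f (sjoin x y) = ereal (of_int l)"
    using f(2) xy unfolding integral_fun_def by (meson smeet_signvecs sjoin_signvecs)
  then have "k + l \<le> n + m" using le by simp
  with kl that show ?thesis by blast
qed

lemma exchange_int_points_P:
  fixes f :: "('v::finite \<Rightarrow> int) \<Rightarrow> ereal"
  assumes f: "bisubmodular f" "integral_fun f"
  shows "exchange (int_points_P f)"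
  unfolding exchange_def
proof (intro ballI allI impI)
  fix p q u
  assume p: "p \<in> int_points_P f" and q: "q \<in> int_points_P f" and u: "p u \<noteq> q u"
  define s where "s = sgn (q u - p u)"
  have s: "s = 1 \<or> s = -1" using u by (auto simp: s_def sgn_if)
  have ple: "ip p x \<le> n" if "x \<in> signvecs" "f x = ereal (of_int n)" for x n
    using p that unfolding int_points_P_def by force
  define T where "T = {x \<in> signvecs. f x = ereal (of_int (ip p x)) \<and> x u = s}"
  \<comment> \<open>Tight vectors attain equality in the bisubmodular inequality, since
    \<open>p\<close> bounds \<open>k\<close> and \<open>l\<close> from below.\<close>
  have meet_T: "smeet x y \<in> T" if T: "x \<in> T" "y \<in> T" for x y
  proof -
    have xy: "x \<in> signvecs" "y \<in> signvecs" using that by (auto simp: T_def)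
    obtain k l where kl: "f (smeet x y) = ereal (of_int k)" "f (sjoin x y) = ereal (of_int l)"
      "k + l \<le> ip p x + ip p y"
      using bisubmodular_integer[OF f xy, of "ip p x" "ip p y"] T unfolding T_def by blast
    have "ip p (smeet x y) \<le> k" "ip p (sjoin x y) \<le> l" using kl xy ple by auto
    then have "k = ip p (smeet x y)" using kl(3) ip_smeet_sjoin[OF xy, of p] by linarith
    moreover have "smeet x y u = s" using T by (simp add: T_def smeet_def)
    ultimately show ?thesis using kl xy by (simp add: T_def)
  qed
  show "\<exists>v. p v \<noteq> q v \<and> (\<lambda>w. p w + toward p q u v w) \<in> int_points_P f"
  proof (cases "(\<lambda>w. p w + toward p q u u w) \<in> int_points_P f")
    case True
    then show ?thesis using u by blast
  next
    case False
    then obtain x where x: "x \<in> signvecs" "\<not> ereal (of_int (ip p x + s * x u)) \<le> f x"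
      by (auto simp: int_points_P_def ip_add ip_toward s_def)
    then obtain n where n: "f x = ereal (of_int n)"
      using f(2) unfolding integral_fun_def by force
    have "n < ip p x + s * x u" using x(2) unfolding n ereal_less_eq of_int_le_iff by linarith
    moreover have "ip p x \<le> n" using ple x(1) n by blast
    \<comment> \<open>A unit step changes the product by at most 1, so integrality forces the
      violated constraint to be tight at \<open>p\<close>.\<close>
    ultimately have "s * x u > 0" "n - ip p x < s * x u" by linarith+
    moreover have "x u \<in> {-1, 0, 1}" using x(1) by (simp add: signvecs_def)
    ultimately have "x u = s" "n = ip p x" using \<open>ip p x \<le> n\<close> s by auto
    then have "x \<in> T" using x n by (simp add: T_def)
    then obtain x0 where x0: "x0 \<in> T" "\<And>y. y \<in> T \<Longrightarrow> card (supp x0) \<le> card (supp y)"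
      using ex_has_least_nat[of "\<lambda>x. x \<in> T" x "\<lambda>x. card (supp x)"] by blast
    \<comment> \<open>\<open>T\<close> is closed under \<open>smeet\<close>, so an element of
      smallest support is the least one: meeting it with \<open>y\<close> cannot shrink its
      support.\<close>
    have min: "y v = x0 v" if y: "y \<in> T" and v: "x0 v \<noteq> 0" for y v
    proof -
      have "supp (smeet x0 y) \<subseteq> supp x0" by (auto simp: supp_def smeet_def)
      then have "supp (smeet x0 y) = supp x0"
        by (intro card_seteq) (auto intro!: x0 meet_T y)
      then have "smeet x0 y v \<noteq> 0" using v by (auto simp: supp_def)
      then show ?thesis by (auto simp: smeet_def split: if_splits)
    qed
    have x0': "x0 \<in> signvecs" "f x0 = ereal (of_int (ip p x0))" "x0 u = s"
      using x0 by (auto simp: T_def)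
    have "ip q x0 \<le> ip p x0" using q x0' unfolding int_points_P_def by force
    then have "(\<Sum>w\<in>UNIV. (q w - p w) * x0 w) \<le> 0"
      by (simp add: ip_def algebra_simps sum_subtractf)
    moreover have pos: "(q u - p u) * x0 u > 0" using u x0'(3) by (auto simp: s_def sgn_if)
    ultimately obtain v where v: "(q v - p v) * x0 v < 0"
      by (metis (no_types, lifting) UNIV_I finite not_less sum_pos2)
    define t where "t = sgn (q v - p v)"
    have x0v: "x0 v = - t" "t = 1 \<or> t = -1" and qv: "p v \<noteq> q v"
      using v x0'(1) by (auto simp: t_def signvecs_def sgn_if dest!: spec[of _ v])
    have uv: "u \<noteq> v" using v pos by auto
    have "ereal (of_int (ip p x + (s * x u + t * x v))) \<le> f x" if x: "x \<in> signvecs" for x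
    proof (cases "f x = \<infinity>")
      case False
      then obtain n where n: "f x = ereal (of_int n)"
        using f(2) x unfolding integral_fun_def by blast
      have xu: "x u \<in> {-1, 0, 1}" and xv: "x v \<in> {-1, 0, 1}" using x by (auto simp: signvecs_def)
      have pn: "ip p x \<le> n" using ple x n by blast
      obtain k l where kl: "f (smeet x x0) = ereal (of_int k)" "f (sjoin x x0) = ereal (of_int l)"
        "k + l \<le> n + ip p x0"
        using bisubmodular_integer[OF f x x0'(1) n x0'(2)] by blast
      have pkl: "ip p (smeet x x0) \<le> k" "ip p (sjoin x x0) \<le> l" using kl x x0' ple by auto
      \<comment> \<open>A tight meet or join with value \<open>s\<close> at \<open>u\<close> would
        lie in \<open>T\<close>, and \<open>min\<close> forbids it to vanish at
        \<open>v\<close>.\<close>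
      have k: False if "k = ip p (smeet x x0)" "smeet x x0 u = s" "smeet x x0 v = 0"
        using min[of "smeet x x0" v] that kl x x0' x0v by (auto simp: T_def)
      have l: False if "l = ip p (sjoin x x0)" "sjoin x x0 u = s" "sjoin x x0 v = 0"
        using min[of "sjoin x x0" v] that kl x x0' x0v by (auto simp: T_def)
      have sum: "k + l - ip p (smeet x x0) - ip p (sjoin x x0) \<le> n - ip p x"
        using ip_smeet_sjoin[OF x x0'(1), of p] kl(3) by linarith
      have "s * x u + t * x v \<le> n - ip p x"
      proof (rule ccontr)
        assume neg: "\<not> ?thesis"
        \<comment> \<open>The slack of \<open>x\<close> bounds the sum of the slacks of meet and
          join. In the first case this sum is at most 1, so one of the two is tight; in the others
          it is 0.\<close>
        consider "x u = s" "x v = t" "n - ip p x \<le> 1" | "x u = s" "x v = 0" "n = ip p x"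
          | "x u = 0" "x v = t" "n = ip p x"
          using neg xu xv pn s x0v(2) by auto
        then show False
        proof cases
          case 1
          have "smeet x x0 u = s" "smeet x x0 v = 0" "sjoin x x0 u = s" "sjoin x x0 v = 0"
            using 1 x0' x0v s by (auto simp: smeet_def sjoin_def)
          then show False using k l pkl sum 1(3) by linarith
        next
          case 2
          have "smeet x x0 u = s" "smeet x x0 v = 0"
            using 2 x0' x0v s by (auto simp: smeet_def)
          then show False using k pkl sum 2(3) by linarith
        next
          case 3
          have "sjoin x x0 u = s" "sjoin x x0 v = 0"
            using 3 x0' x0v s by (auto simp: sjoin_def)
          then show False using l pkl sum 3(3) by linarith
        qed
      qed
      then have "ip p x + (s * x u + t * x v) \<le> n" by linarith
      then show ?thesis unfolding n by (simp only: ereal_less_eq of_int_le_iff)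
    qed simp
    then have "(\<lambda>w. p w + toward p q u v w) \<in> int_points_P f"
      using uv by (simp add: int_points_P_def ip_add ip_toward s_def t_def)
    then show ?thesis using qv by blast
  qed
qed

subsection \<open>Sets with the exchange property are BS-convex\<close>

text \<open>The two given points differ only at \<open>v\<close>, by 2, so an exchange between them
  must land on the midpoint.\<close>

lemma exchange_no_gap:
  fixes B :: "('v::finite \<Rightarrow> int) set"
  assumes E: "exchange B" and "p(u := p u + s, v := p v + 1) \<in> B" "p(u := p u + s, v := p v - 1) \<in> B"
    and "u \<noteq> v"
  shows "p(u := p u + s) \<in> B"
proof -
  let ?p = "p(u := p u + s, v := p v + 1)" and ?q = "p(u := p u + s, v := p v - 1)"
  obtain w where w: "?p w \<noteq> ?q w" "(\<lambda>x. ?p x + toward ?p ?q v w x) \<in> B"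
    using exchangeE[OF E assms(2,3), of v] by auto
  then have "w = v" by (auto split: if_splits)
  then have "(\<lambda>x. ?p x + toward ?p ?q v w x) = p(u := p u + s)"
    using \<open>u \<noteq> v\<close> by (auto simp: toward_def sgn_if)
  then show ?thesis using w(2) by simp
qed

lemma blocking_sign_vector:
  fixes B :: "('v::finite \<Rightarrow> int) set"
  assumes E: "exchange B" and p: "p \<in> B" and s: "s \<in> {-1, 1}" and ns: "p(u := p u + s) \<notin> B"
  obtains x where "x \<in> signvecs" "x u = s"
    "\<And>v t. v \<noteq> u \<Longrightarrow> t \<in> {-1, 1} \<Longrightarrow> x v = - t \<longleftrightarrow> p(u := p u + s, v := p v + t) \<in> B"
    "\<And>q. q \<in> B \<Longrightarrow> ip q x \<le> ip p x"
proof -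
  \<comment> \<open>By \<open>exchange_no_gap\<close> at most one of the two neighbours at
    \<open>v\<close> lies in \<open>B\<close>, so the order of the tests is immaterial.\<close>
  define x where "x = (\<lambda>v. if v = u then s
    else if p(u := p u + s, v := p v + 1) \<in> B then -1
    else if p(u := p u + s, v := p v - 1) \<in> B then 1 else 0)"
  have xs: "x \<in> signvecs" using s by (auto simp: signvecs_def x_def)
  have xu: "x u = s" by (simp add: x_def)
  have xv: "x v = - t \<longleftrightarrow> p(u := p u + s, v := p v + t) \<in> B" if "v \<noteq> u" "t \<in> {-1, 1}" for v t
    using that exchange_no_gap[OF E, of p u s v] ns by (auto simp: x_def)
  define conf where "conf q \<longleftrightarrow> (\<forall>w. x w * (q w - p w) \<ge> 0)" for q
  \<comment> \<open>Moving \<open>p\<close> towards \<open>q\<close> at \<open>u\<close> needs a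
    compensating step at some \<open>v\<close>, where \<open>x\<close> then opposes
    \<open>q - p\<close>.\<close>
  have conf_u: "q u = p u" if q: "q \<in> B" "conf q" for q
  proof (rule ccontr)
    assume qu: "q u \<noteq> p u"
    have "s * (q u - p u) \<ge> 0" using q(2) xu by (auto simp: conf_def)
    then have sg: "sgn (q u - p u) = s" using qu s by (auto simp: sgn_if)
    obtain v where v: "p v \<noteq> q v" "(\<lambda>w. p w + toward p q u v w) \<in> B"
      using exchangeE[OF E p q(1), of u] qu by metis
    show False
    proof (cases "v = u")
      case True
      then have "(\<lambda>w. p w + toward p q u v w) = p(u := p u + s)"
        using sg by (auto simp: toward_def)
      then show False using v ns by simp
    next
      case False
      let ?t = "sgn (q v - p v)"
      have "(\<lambda>w. p w + toward p q u v w) = p(u := p u + s, v := p v + ?t)"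
        using sg False by (auto simp: toward_def)
      moreover have t: "?t \<in> {-1, 1}" using v(1) by (auto simp: sgn_if)
      ultimately have "x v = - ?t" using xv[OF False t] v by simp
      moreover have "x v * (q v - p v) \<ge> 0" using q(2) by (simp add: conf_def)
      ultimately show False using v(1) by (auto simp: sgn_if split: if_splits)
    qed
  qed
  \<comment> \<open>A conforming \<open>q\<close> beating \<open>p\<close> at \<open>w\<close> is moved at \<open>u\<close> towards the neighbour \<open>p'\<close> of \<open>p\<close> that
    witnesses \<open>x w \<noteq> 0\<close>; the result still conforms but now differs from \<open>p\<close> at \<open>u\<close>.\<close>
  have conf_le: "ip q x \<le> ip p x" if q: "q \<in> B" "conf q" for q
  proof (rule ccontr)
    assume "\<not> ?thesis"
    then have "(\<Sum>w\<in>UNIV. x w * (q w - p w)) > 0"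
      by (simp add: ip_def algebra_simps sum_subtractf)
    then obtain w where w: "x w * (q w - p w) > 0"
      by (meson sum_nonpos not_le)
    have wu: "w \<noteq> u" using w conf_u[OF q] by auto
    have xw: "x w \<in> {-1, 1}" using w xs by (auto simp: signvecs_def dest!: spec[of _ w])
    define p' where "p' = p(u := p u + s, w := p w - x w)"
    have "p' \<in> B" using xv[OF wu, of "- x w"] xw by (auto simp: p'_def)
    moreover have "q u \<noteq> p' u" using conf_u[OF q] s wu by (auto simp: p'_def)
    ultimately obtain t where t: "q t \<noteq> p' t" "(\<lambda>v. q v + toward q p' u t v) \<in> B"
      using exchangeE[OF E q(1), of p' u] by metis
    let ?q = "\<lambda>v. q v + toward q p' u t v"
    have qu: "?q u = p u + s"
      using conf_u[OF q] s wu by (auto simp: toward_def p'_def)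
    have "conf ?q"
      unfolding conf_def
    proof
      fix v
      have c: "x v * (q v - p v) \<ge> 0" using q(2) by (simp add: conf_def)
      have xv: "x v \<in> {-1, 0, 1}" using xs by (simp add: signvecs_def)
      \<comment> \<open>At \<open>w\<close>, \<open>q\<close> is strictly on the favourable side of
        \<open>p\<close>, so one unit towards \<open>p'\<close> at most reaches \<open>p w\<close>.
        At any other \<open>t\<close> outside \<open>u\<close> the target is \<open>p t\<close>,
        which is not overshot.\<close>
      consider "v = u" | "v \<noteq> u" "v = t" "v = w" | "v \<noteq> u" "v = t" "v \<noteq> w" | "v \<noteq> u" "v \<noteq> t" by blast
      then show "x v * (?q v - p v) \<ge> 0"
      proof cases
        case 1
        have "?q v - p v = s" using qu 1 by simp
        then show ?thesis using xu 1 by simp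
      next
        case 2
        then show ?thesis using w xw by (auto simp: toward_def p'_def sgn_if)
      next
        case 3
        then show ?thesis using c xv by (auto simp: toward_def p'_def sgn_if)
      next
        case 4
        then show ?thesis using c by (simp add: toward_def)
      qed
    qed
    then have "?q u = p u" using conf_u t by blast
    then show False using qu s by auto
  qed
  \<comment> \<open>Moving a nonconforming \<open>q\<close> towards \<open>p\<close> at an offending
    coordinate never decreases its product with \<open>x\<close>, so conforming points
    suffice.\<close>
  have le: "ip q x \<le> ip p x" if "q \<in> B" for q
    using that
  proof (induction "nat (norm1 (\<lambda>w. p w - q w))" arbitrary: q rule: less_induct)
    case less
    show ?case
    proof (cases "conf q")
      case True
      then show ?thesis using conf_le less.prems by blast
    next
      case False
      then obtain w where w: "x w * (q w - p w) < 0" by (auto simp: conf_def not_le)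
      then have "x w * (p w - q w) > 0" by (simp add: algebra_simps)
      moreover have "x w \<in> {-1, 0, 1}" using xs by (simp add: signvecs_def)
      ultimately have w': "p w - q w \<noteq> 0" "x w = sgn (p w - q w)"
        by (rule sgn_product_cases)+
      then have qw: "q w \<noteq> p w" by simp
      then obtain v where v: "(\<lambda>i. q i + toward q p w v i) \<in> B"
        using exchangeE[OF E less.prems p] by metis
      let ?q = "\<lambda>i. q i + toward q p w v i"
      have "ip q x \<le> ip ?q x"
        using ip_toward_ge[of x w p q v, OF w'(2) qw xs] by (simp add: ip_add)
      also have "nat (norm1 (\<lambda>i. p i - ?q i)) < nat (norm1 (\<lambda>w. p w - q w))"
        using dist_toward_less[of q w p v, OF qw] norm1_nonneg[of "\<lambda>i. p i - ?q i"] by linarith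
      then have "ip ?q x \<le> ip p x" using less.hyps[of ?q] v by simp
      finally show ?thesis .
    qed
  qed
  show ?thesis by (rule that[OF xs xu xv le])
qed

text \<open>The integer points of the polyhedron of the support function of \<open>B\<close>; integrality allows the
  supremum to be replaced by an existential.\<close>

definition sign_hull :: "('v::finite \<Rightarrow> int) set \<Rightarrow> ('v \<Rightarrow> int) set" where
  "sign_hull B = {z. \<forall>x\<in>signvecs. \<exists>q\<in>B. ip z x \<le> ip q x}"

text \<open>If the step were missing from \<open>B\<close>, it would gain 1 on its blocking vector,
  which \<open>p\<close> already maximises over \<open>B\<close>.\<close>

lemma sign_hull_upd:
  assumes "exchange B" "p \<in> B" "s \<in> {-1, 1}" "p(u := p u + s) \<in> sign_hull B"
  shows "p(u := p u + s) \<in> B"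
proof (rule ccontr)
  assume n: "\<not> ?thesis"
  obtain x where x: "x \<in> signvecs" "x u = s" "\<And>q. q \<in> B \<Longrightarrow> ip q x \<le> ip p x"
    using blocking_sign_vector[OF assms(1-3) n] by metis
  obtain q where "q \<in> B" "ip (p(u := p u + s)) x \<le> ip q x"
    using assms(4) x(1) by (auto simp: sign_hull_def)
  moreover have "p(u := p u + s) = (\<lambda>w. p w + toward p (p(u := p u + s)) u u w)"
    using assms(3) by (auto simp: toward_def)
  then have "ip (p(u := p u + s)) x = ip p x + ip (toward p (p(u := p u + s)) u u) x"
    using ip_add by metis
  then have "ip (p(u := p u + s)) x = ip p x + 1"
    using assms(3) x(2) by (auto simp: ip_toward)
  ultimately show False using x(3)[of q] by linarith
qed

text \<open>If the unit step at \<open>u\<close> stays in \<open>B\<close>, a second unit step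
  follows by \<open>sign_hull_upd\<close>. Otherwise, were the double step missing, the blocking
  vector would not oppose it at \<open>v\<close>, so the step would strictly gain on a vector
  maximised at \<open>p\<close>.\<close>

lemma sign_hull_local:
  assumes E: "exchange B" and p: "p \<in> B" and uv: "p u \<noteq> z u" "p v \<noteq> z v"
    and H: "(\<lambda>w. p w + toward p z u v w) \<in> sign_hull B"
  shows "(\<lambda>w. p w + toward p z u v w) \<in> B"
proof -
  let ?s = "sgn (z u - p u)" and ?t = "sgn (z v - p v)"
  have s: "?s \<in> {-1, 1}" and t: "?t \<in> {-1, 1}" using uv by (auto simp: sgn_if)
  show ?thesis
  proof (cases "u = v")
    case True
    then have "(\<lambda>w. p w + toward p z u v w) = p(u := p u + ?s)" by (auto simp: toward_def)
    then show ?thesis using sign_hull_upd[OF E p s] H by simp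
  next
    case False
    have eq: "(\<lambda>w. p w + toward p z u v w) = p(u := p u + ?s, v := p v + ?t)"
      using False by (auto simp: toward_def)
    show ?thesis
    proof (cases "p(u := p u + ?s) \<in> B")
      case True
      then show ?thesis
        using sign_hull_upd[OF E True t, of v] H False unfolding eq by simp
    next
      case n: False
      show ?thesis
      proof (rule ccontr)
        assume c: "\<not> ?thesis"
        obtain x where x: "x \<in> signvecs" "x u = ?s"
          "x v = - ?t \<longleftrightarrow> p(u := p u + ?s, v := p v + ?t) \<in> B" "\<And>q. q \<in> B \<Longrightarrow> ip q x \<le> ip p x"
          using blocking_sign_vector[OF E p s n] False t by metis
        obtain q where "q \<in> B" "ip (\<lambda>w. p w + toward p z u v w) x \<le> ip q x"
          using H x(1) by (auto simp: sign_hull_def)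
        then have "ip (toward p z u v) x \<le> 0" using x(4)[of q] by (simp add: ip_add)
        moreover have "x v \<in> {-1, 0, 1}" using x(1) by (simp add: signvecs_def)
        moreover have "x v \<noteq> - ?t" using x(3) c eq by simp
        ultimately show False using False s t x(2) uv by (auto simp: ip_toward)
      qed
    qed
  qed
qed

text \<open>Integers that all stay below \<open>n\<close> are bounded by \<open>n - 1\<close>, hence
  so is their supremum.\<close>

lemma ereal_int_le_SUP_iff:
  fixes g :: "'a \<Rightarrow> int"
  assumes "B \<noteq> {}"
  shows "ereal (of_int n) \<le> (SUP q\<in>B. ereal (of_int (g q))) \<longleftrightarrow> (\<exists>q\<in>B. n \<le> g q)"
proof
  assume L: "ereal (of_int n) \<le> (SUP q\<in>B. ereal (of_int (g q)))"
  show "\<exists>q\<in>B. n \<le> g q"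
  proof (rule ccontr)
    assume "\<not> ?thesis"
    then have "\<forall>q\<in>B. g q \<le> n - 1" by force
    then have "(SUP q\<in>B. ereal (of_int (g q))) \<le> ereal (of_int (n - 1))"
      by (intro SUP_least) (simp only: ereal_less_eq of_int_le_iff)
    with L have "ereal (of_int n) \<le> ereal (of_int (n - 1))" by (rule order_trans)
    then show False by simp
  qed
next
  assume "\<exists>q\<in>B. n \<le> g q"
  then obtain q where "q \<in> B" "n \<le> g q" by blast
  then show "ereal (of_int n) \<le> (SUP q\<in>B. ereal (of_int (g q)))"
    by (intro SUP_upper2[of q]) auto
qed

lemma SUP_int_cases:
  fixes g :: "'a \<Rightarrow> int"
  assumes "B \<noteq> {}"
  obtains "(SUP q\<in>B. ereal (of_int (g q))) = \<infinity>"
  | q where "q \<in> B" "(SUP q\<in>B. ereal (of_int (g q))) = ereal (of_int (g q))"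
proof (cases "\<exists>b. \<forall>q\<in>B. g q \<le> b")
  case True
  then obtain b where b: "\<forall>q\<in>B. g q \<le> b" by blast
  obtain q0 where "q0 \<in> B" using assms by blast
  then obtain q where q: "q \<in> B" "\<And>y. y \<in> B \<Longrightarrow> nat (b - g q) \<le> nat (b - g y)"
    using ex_has_least_nat[of "\<lambda>q. q \<in> B" q0 "\<lambda>q. nat (b - g q)"] by blast
  have "g y \<le> g q" if "y \<in> B" for y using q(2)[OF that] b that q(1) by force
  then have "(SUP q\<in>B. ereal (of_int (g q))) = ereal (of_int (g q))"
    using q(1) by (intro SUP_eqI) auto
  then show ?thesis using that(2) q(1) by blast
next
  case False
  have "ereal x \<le> (SUP q\<in>B. ereal (of_int (g q)))" for x
  proof -
    obtain q where "q \<in> B" "\<lceil>x\<rceil> \<le> g q" using False by (meson linear)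
    then show ?thesis by (intro SUP_upper2[of q]) (auto simp: ceiling_le_iff)
  qed
  then have "(SUP q\<in>B. ereal (of_int (g q))) = \<infinity>" by (intro ereal_top) auto
  then show ?thesis using that(1) by blast
qed

lemma exchange_imp_BS_convex:
  fixes B :: "('v::finite \<Rightarrow> int) set"
  assumes E: "exchange B" and ne: "B \<noteq> {}"
  shows "BS_convex B"
proof -
  define f where "f x = (SUP q\<in>B. ereal (of_int (ip q x)))" for x
  have f_cases: "f x = \<infinity> \<or> (\<exists>q\<in>B. f x = ereal (of_int (ip q x)))" for x
    unfolding f_def by (rule SUP_int_cases[OF ne, of "\<lambda>q. ip q x"]) blast+
  have f_ge: "ereal (of_int (ip q x)) \<le> f x" if "q \<in> B" for q x
    unfolding f_def using that by (rule SUP_upper)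
  have f_minf: "f x \<noteq> -\<infinity>" for x using f_cases[of x] by auto
  have bis: "f (smeet x y) + f (sjoin x y) \<le> f x + f y" if xy: "x \<in> signvecs" "y \<in> signvecs" for x y
  proof -
    \<comment> \<open>A single \<open>r\<close> serves both sign vectors, so the modular identity
      turns its two products into products with \<open>x\<close> and \<open>y\<close>. The points
      \<open>p\<close> and \<open>q\<close> remain independent, so the suprema can be taken one
      after the other.\<close>
    have fin: "ereal (of_int (ip p (smeet x y))) + ereal (of_int (ip q (sjoin x y))) \<le> f x + f y"
      if pq: "p \<in> B" "q \<in> B" for p q
    proof -
      obtain r where r: "r \<in> B" "ip p (smeet x y) \<le> ip r (smeet x y)" "ip q (sjoin x y) \<le> ip r (sjoin x y)"
        using exchange_two_phase[OF E pq smeet_signvecs[OF xy] sjoin_signvecs[OF xy] smeet_below_sjoin]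
        by metis
      have "ip p (smeet x y) + ip q (sjoin x y) \<le> ip r x + ip r y"
        using r ip_smeet_sjoin[OF xy, of r] by linarith
      then have "ereal (of_int (ip p (smeet x y))) + ereal (of_int (ip q (sjoin x y)))
          \<le> ereal (of_int (ip r x)) + ereal (of_int (ip r y))"
        by (simp flip: of_int_add)
      also have "\<dots> \<le> f x + f y" by (intro add_mono f_ge r)
      finally show ?thesis .
    qed
    show ?thesis
    proof (cases "f x + f y = \<infinity>")
      case False
      have "f (smeet x y) + ereal (of_int (ip q (sjoin x y))) \<le> f x + f y" if "q \<in> B" for q
        unfolding f_def[of "smeet x y"]
        by (subst SUP_ereal_add_left[symmetric]) (use ne fin that in \<open>auto intro!: SUP_least\<close>)
      then show ?thesis
        unfolding f_def[of "sjoin x y"]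
        by (subst SUP_ereal_add_right[symmetric]) (use ne f_minf in \<open>auto intro!: SUP_least\<close>)
    qed (simp only: ereal_less_eq)
  qed
  have f0: "f (\<lambda>_. 0) = 0" using ne by (simp add: f_def ip_def zero_ereal_def)
  have f: "bisubmodular f" unfolding bisubmodular_def using f0 f_minf bis by blast
  have fi: "integral_fun f" unfolding integral_fun_def using f_cases by blast
  have P: "int_points_P f = sign_hull B"
    unfolding int_points_P_def sign_hull_def f_def by (simp add: ereal_int_le_SUP_iff[OF ne])
  have sub: "B \<subseteq> sign_hull B" by (auto simp: sign_hull_def)
  \<comment> \<open>The walk to \<open>z\<close> chooses its steps by exchange inside the hull;
    \<open>sign_hull_local\<close> then pulls each step back into \<open>B\<close>.\<close>
  have EH: "exchange (sign_hull B)" using exchange_int_points_P[OF f fi] P by simp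
  have "z \<in> B" if z: "z \<in> sign_hull B" and "p \<in> B" for z p
    using \<open>p \<in> B\<close>
  proof (induction "nat (norm1 (\<lambda>w. z w - p w))" arbitrary: p rule: less_induct)
    case less
    show ?case
    proof (cases "p = z")
      case False
      then obtain u where u: "p u \<noteq> z u" by blast
      then obtain v where v: "p v \<noteq> z v" "(\<lambda>w. p w + toward p z u v w) \<in> sign_hull B"
        using exchangeE[OF EH _ z] sub less.prems by blast
      have "nat (norm1 (\<lambda>w. z w - (p w + toward p z u v w))) < nat (norm1 (\<lambda>w. z w - p w))"
        using dist_toward_less[of p u z v, OF u]
          norm1_nonneg[of "\<lambda>w. z w - (p w + toward p z u v w)"] by linarith
      then show ?thesis
        using less.hyps[of "\<lambda>w. p w + toward p z u v w"] sign_hull_local[OF E less.prems u v] by simp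
    qed (use less.prems in simp)
  qed
  then have "B = int_points_P f" using ne sub P by blast
  then show ?thesis using f fi unfolding BS_convex_def by blast
qed

subsection \<open>Hall's theorem\<close>

text \<open>The Halmos-Vaughan induction: split along a tight proper subfamily if there is one;
  otherwise every proper subfamily has a value to spare and any first choice is harmless.\<close>

lemma hall:
  fixes A :: "'i \<Rightarrow> 'a set"
  assumes "finite I" "\<And>i. i \<in> I \<Longrightarrow> finite (A i)"
    and "\<And>J. J \<subseteq> I \<Longrightarrow> card J \<le> card (\<Union>(A ` J))"
  obtains R where "inj_on R I" "\<And>i. i \<in> I \<Longrightarrow> R i \<in> A i"
proof -
  have "\<exists>R. inj_on R I \<and> (\<forall>i\<in>I. R i \<in> A i)"
    using assms
  proof (induction "card I" arbitrary: I A rule: less_induct)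
    case less
    note fin = less.prems(1,2) and hall = less.prems(3)
    show ?case
    proof (cases "I = {}")
      case True
      then show ?thesis by simp
    next
      case False
      show ?thesis
      proof (cases "\<exists>J. J \<subset> I \<and> J \<noteq> {} \<and> card (\<Union>(A ` J)) = card J")
        case True
        then obtain J where J: "J \<subset> I" "J \<noteq> {}" "card (\<Union>(A ` J)) = card J" by blast
        have finJ: "finite J" using J fin finite_subset by blast
        have "card J < card I" using J fin by (simp add: psubset_card_mono)
        then have "\<exists>R. inj_on R J \<and> (\<forall>i\<in>J. R i \<in> A i)"
          using J by (intro less.hyps finJ fin hall) auto
        then obtain R where R: "inj_on R J" "\<forall>i\<in>J. R i \<in> A i" by blast
        let ?U = "\<Union>(A ` J)"
        define A' where "A' = (\<lambda>i. A i - ?U)"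
        \<comment> \<open>Apply the condition to the union of \<open>K\<close> and \<open>J\<close>;
          tightness means that \<open>J\<close> accounts for exactly \<open>card J\<close> of the
          values.\<close>
        have "card K \<le> card (\<Union>(A' ` K))" if K: "K \<subseteq> I - J" for K
        proof -
          have finK: "finite K" using K fin finite_subset by blast
          have "card K + card J = card (K \<union> J)"
            using K finK finJ by (subst card_Un_disjoint) auto
          also have "\<dots> \<le> card (\<Union>(A ` (K \<union> J)))" using K J by (intro hall) auto
          also have "\<Union>(A ` (K \<union> J)) = \<Union>(A' ` K) \<union> ?U" by (auto simp: A'_def)
          also have "card \<dots> \<le> card (\<Union>(A' ` K)) + card ?U" by (rule card_Un_le)
          finally show ?thesis using J by simp
        qed
        moreover have "card (I - J) < card I"
          using J fin finJ by (intro psubset_card_mono) auto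
        ultimately have "\<exists>R. inj_on R (I - J) \<and> (\<forall>i\<in>I - J. R i \<in> A' i)"
          using fin by (intro less.hyps) (simp_all add: A'_def)
        then obtain R' where R': "inj_on R' (I - J)" "\<forall>i\<in>I - J. R' i \<in> A' i" by blast
        define S where "S = (\<lambda>i. if i \<in> J then R i else R' i)"
        have "inj_on S I"
        proof (rule inj_onI)
          fix i j assume ij: "i \<in> I" "j \<in> I" "S i = S j"
          have 1: "R a \<in> ?U" if "a \<in> J" for a using R that by blast
          have 2: "R' a \<notin> ?U" if "a \<in> I - J" for a using R' that by (auto simp: A'_def)
          show "i = j"
            using ij 1[of i] 1[of j] 2[of i] 2[of j] R(1) R'(1)
            by (cases "i \<in> J"; cases "j \<in> J") (auto simp: S_def dest: inj_onD)
        qed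
        moreover have "\<forall>i\<in>I. S i \<in> A i" using R R' by (auto simp: S_def A'_def)
        ultimately show ?thesis by blast
      next
        case strict: False
        obtain i where i: "i \<in> I" using \<open>I \<noteq> {}\<close> by blast
        have "A i \<noteq> {}" using hall[of "{i}"] i by auto
        then obtain a where a: "a \<in> A i" by blast
        define A' where "A' = (\<lambda>j. A j - {a})"
        have "card K \<le> card (\<Union>(A' ` K))" if K: "K \<subseteq> I - {i}" for K
        proof (cases "K = {}")
          case False
          have "K \<subset> I" using K i by blast
          then have "card (\<Union>(A ` K)) \<noteq> card K" using False strict by blast
          moreover have "card K \<le> card (\<Union>(A ` K))" using K by (intro hall) auto
          moreover have "\<Union>(A' ` K) = \<Union>(A ` K) - {a}" by (auto simp: A'_def)
          moreover have "card (\<Union>(A ` K)) - 1 \<le> card (\<Union>(A ` K) - {a})"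
            by (metis card_Diff1_le card_Diff_singleton_if diff_le_self le_refl)
          ultimately show ?thesis by simp
        qed simp
        moreover have "card (I - {i}) < card I" using i fin by (intro card_Diff1_less)
        ultimately have "\<exists>R. inj_on R (I - {i}) \<and> (\<forall>j\<in>I - {i}. R j \<in> A' j)"
          using fin by (intro less.hyps) (simp_all add: A'_def)
        then obtain R where R: "inj_on R (I - {i})" "\<forall>j\<in>I - {i}. R j \<in> A' j" by blast
        have "inj_on (R(i := a)) I"
          using R by (auto simp: inj_on_def A'_def)
        moreover have "\<forall>j\<in>I. (R(i := a)) j \<in> A j" using R a by (auto simp: A'_def)
        ultimately show ?thesis by blast
      qed
    qed
  qed
  then show ?thesis using that by blast
qed

subsection \<open>Half-integral decompositions\<close>

text \<open>The point \<open>r\<close> is as good as \<open>p\<close> on the meet and as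
  \<open>q\<close> on the join. Since \<open>p\<close> is best for \<open>x\<close> and
  \<open>y\<close> together, \<open>r\<close> cannot beat it on the join.\<close>

lemma sjoin_maximal:
  fixes B :: "('v::finite \<Rightarrow> int) set"
  assumes E: "exchange B" and p: "p \<in> B" and xy: "x \<in> signvecs" "y \<in> signvecs"
    and x: "\<And>q. q \<in> B \<Longrightarrow> ip q x \<le> ip p x" and y: "\<And>q. q \<in> B \<Longrightarrow> ip q y \<le> ip p y"
    and q: "q \<in> B"
  shows "ip q (sjoin x y) \<le> ip p (sjoin x y)"
proof -
  obtain r where r: "r \<in> B" "ip p (smeet x y) \<le> ip r (smeet x y)" "ip q (sjoin x y) \<le> ip r (sjoin x y)"
    using exchange_two_phase[OF E p q smeet_signvecs[OF xy] sjoin_signvecs[OF xy] smeet_below_sjoin]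
    by metis
  then show ?thesis
    using x[OF r(1)] y[OF r(1)] ip_smeet_sjoin[OF xy, of r] ip_smeet_sjoin[OF xy, of p] by linarith
qed

text \<open>Neighbourhood of \<open>W\<close> in the graph of feasible steps. Unit steps are loops,
  so a set disjoint from its neighbourhood admits none.\<close>

definition exch_nbrs :: "('v \<Rightarrow> int) set \<Rightarrow> ('v \<Rightarrow> int) \<Rightarrow> ('v \<Rightarrow> int) \<Rightarrow> 'v set \<Rightarrow> 'v set" where
  "exch_nbrs B p q W = {v. p v \<noteq> q v \<and> (\<exists>u\<in>W. (\<lambda>w. p w + toward p q u v w) \<in> B)}"

lemma exch_nbrs_stable:
  fixes B :: "('v::finite \<Rightarrow> int) set"
  assumes E: "exchange B" and p: "p \<in> B" and q: "q \<in> B"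
    and W: "\<And>u. u \<in> W \<Longrightarrow> p u \<noteq> q u" and stable: "W \<inter> exch_nbrs B p q W = {}"
  shows "(\<Sum>u\<in>W. \<bar>q u - p u\<bar>) \<le> (\<Sum>u\<in>exch_nbrs B p q W. \<bar>q u - p u\<bar>)"
proof -
  let ?N = "exch_nbrs B p q W" and ?s = "\<lambda>u. sgn (q u - p u)"
  have join: "\<exists>x\<in>signvecs. (\<forall>r\<in>B. ip r x \<le> ip p x) \<and> (\<forall>u\<in>U. x u = ?s u) \<and>
      (\<forall>v. p v \<noteq> q v \<longrightarrow> x v = - ?s v \<longrightarrow> v \<in> ?N)" if "U \<subseteq> W" for U
    using finite[of U] that
  proof (induction U rule: finite_induct)
    case empty
    show ?case
      by (rule bexI[of _ "\<lambda>_. 0"]) (auto simp: ip_def signvecs_def sgn_if)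
  next
    case (insert u U)
    then obtain x where x: "x \<in> signvecs" "\<And>r. r \<in> B \<Longrightarrow> ip r x \<le> ip p x" "\<And>u. u \<in> U \<Longrightarrow> x u = ?s u"
      "\<And>v. p v \<noteq> q v \<Longrightarrow> x v = - ?s v \<Longrightarrow> v \<in> ?N" by blast
    have u: "u \<in> W" "p u \<noteq> q u" using insert.prems W by auto
    have su: "?s u \<in> {-1, 1}" using u by (auto simp: sgn_if)
    have "(\<lambda>w. p w + toward p q u u w) \<notin> B"
      using stable u unfolding exch_nbrs_def by blast
    moreover have "(\<lambda>w. p w + toward p q u u w) = p(u := p u + ?s u)" by (auto simp: toward_def)
    ultimately have "p(u := p u + ?s u) \<notin> B" by simp
    then obtain y where y: "y \<in> signvecs" "y u = ?s u"
      "\<And>v t. v \<noteq> u \<Longrightarrow> t \<in> {-1, 1} \<Longrightarrow> y v = - t \<longleftrightarrow> p(u := p u + ?s u, v := p v + t) \<in> B"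
      "\<And>r. r \<in> B \<Longrightarrow> ip r y \<le> ip p y"
      using blocking_sign_vector[OF E p su] by metis
    have yN: "v \<in> ?N" if "p v \<noteq> q v" "y v = - ?s v" for v
    proof -
      have vu: "v \<noteq> u" using that y(2) su by auto
      have "?s v \<in> {-1, 1}" using that by (auto simp: sgn_if)
      then have "p(u := p u + ?s u, v := p v + ?s v) \<in> B" using y(3)[OF vu] that by blast
      moreover have "(\<lambda>w. p w + toward p q u v w) = p(u := p u + ?s u, v := p v + ?s v)"
        using vu by (auto simp: toward_def)
      ultimately have "(\<lambda>w. p w + toward p q u v w) \<in> B" by simp
      then show ?thesis using u(1) that by (auto simp: exch_nbrs_def)
    qed
    \<comment> \<open>A value opposing \<open>q - p\<close> would make \<open>w\<close> a neighbour
      of \<open>W\<close>, against stability; so the join cancels nothing on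
      \<open>W\<close>.\<close>
    have xW: "x w \<in> {0, ?s w}" and yW: "y w \<in> {0, ?s w}" if "w \<in> W" for w
      using x(1) y(1) x(4)[of w] yN[of w] W[OF that] stable that
      by (auto simp: signvecs_def sgn_if dest!: spec[of _ w])
    show ?case
    proof (rule bexI[of _ "sjoin x y"], intro conjI ballI allI impI)
      fix r assume "r \<in> B"
      then show "ip r (sjoin x y) \<le> ip p (sjoin x y)"
        by (intro sjoin_maximal[OF E p x(1) y(1)] x(2) y(4))
    next
      fix w assume w: "w \<in> insert u U"
      then have "w \<in> W" using insert.prems by auto
      then show "sjoin x y w = ?s w"
        using xW[of w] yW[of w] w x(3)[of w] y(2) by (auto simp: sjoin_def)
    next
      fix v assume v: "p v \<noteq> q v" "sjoin x y v = - ?s v"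
      then have "- ?s v \<noteq> 0" by (auto simp: sgn_if)
      then have "x v = - ?s v \<or> y v = - ?s v"
        using v(2) by (auto simp: sjoin_def split: if_splits)
      then show "v \<in> ?N" using x(4) yN v by blast
    qed (use x y in simp)
  qed
  obtain x where x: "x \<in> signvecs" "\<And>r. r \<in> B \<Longrightarrow> ip r x \<le> ip p x" "\<And>u. u \<in> W \<Longrightarrow> x u = ?s u"
    "\<And>v. p v \<noteq> q v \<Longrightarrow> x v = - ?s v \<Longrightarrow> v \<in> ?N"
    using join[OF order_refl] by blast
  have "(\<Sum>u\<in>W. \<bar>q u - p u\<bar>) - (\<Sum>u\<in>?N. \<bar>q u - p u\<bar>)
      = (\<Sum>u\<in>UNIV. (if u \<in> W then \<bar>q u - p u\<bar> else 0) - (if u \<in> ?N then \<bar>q u - p u\<bar> else 0))"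
    by (simp add: sum_subtractf sum.If_cases)
  \<comment> \<open>Termwise: \<open>x\<close> earns the full distance on \<open>W\<close> and can
    lose only on the neighbourhood.\<close>
  also have "\<dots> \<le> (\<Sum>u\<in>UNIV. (q u - p u) * x u)"
  proof (rule sum_mono)
    fix u
    have xu: "x u \<in> {-1, 0, 1}" using x(1) by (simp add: signvecs_def)
    show "(if u \<in> W then \<bar>q u - p u\<bar> else 0) - (if u \<in> ?N then \<bar>q u - p u\<bar> else 0) \<le> (q u - p u) * x u"
      using xu x(3)[of u] x(4)[of u] stable
      by (cases "u \<in> W"; cases "u \<in> ?N") (auto simp: sgn_if split: if_splits)
  qed
  also have "\<dots> = ip q x - ip p x"
    by (simp add: ip_def algebra_simps sum_subtractf)
  also have "\<dots> \<le> 0" using x(2)[OF q] by simp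
  finally show ?thesis by simp
qed

text \<open>The elements of \<open>W\<close> without a neighbour in \<open>W\<close> are stable, and their neighbours lie outside \<open>W\<close>.\<close>

lemma exch_nbrs_hall:
  fixes B :: "('v::finite \<Rightarrow> int) set"
  assumes "exchange B" "p \<in> B" "q \<in> B" and W: "\<And>u. u \<in> W \<Longrightarrow> p u \<noteq> q u"
  shows "(\<Sum>u\<in>W. \<bar>q u - p u\<bar>) \<le> (\<Sum>u\<in>exch_nbrs B p q W. \<bar>q u - p u\<bar>)"
proof -
  let ?N = "exch_nbrs B p q" and ?S = "\<lambda>U. \<Sum>u\<in>U. \<bar>q u - p u\<bar>"
  have sub: "?N (W - ?N W) \<subseteq> ?N W - W"
  proof
    fix v assume "v \<in> ?N (W - ?N W)"
    then obtain u where u: "p v \<noteq> q v" "u \<in> W" "u \<notin> ?N W" "(\<lambda>w. p w + toward p q u v w) \<in> B"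
      by (auto simp: exch_nbrs_def)
    moreover have "v \<notin> W"
      using u W[of u] toward_commute[of p q u v] by (auto simp: exch_nbrs_def)
    ultimately show "v \<in> ?N W - W" by (auto simp: exch_nbrs_def)
  qed
  have "?S W = ?S (W \<inter> ?N W) + ?S (W - ?N W)"
    by (rule sum.Int_Diff) simp
  also have "?S (W - ?N W) \<le> ?S (?N (W - ?N W))"
    using W sub by (intro exch_nbrs_stable assms) auto
  also have "\<dots> \<le> ?S (?N W - W)"
    using sub by (intro sum_mono2) auto
  also have "?S (W \<inter> ?N W) + ?S (?N W - W) = ?S (?N W)"
    by (subst Int_commute) (rule sum.Int_Diff[symmetric], simp)
  finally show ?thesis by simp
qed

lemma exchange_imp_bs_exc:
  fixes B :: "('v::finite \<Rightarrow> int) set"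
  assumes E: "exchange B"
  shows "bs_exc B"
  unfolding bs_exc_def
proof (intro ballI)
  fix p q assume p: "p \<in> B" and q: "q \<in> B"
  define m where "m u = nat \<bar>q u - p u\<bar>" for u
  \<comment> \<open>The clones turn the weighted inequality of \<open>exch_nbrs_hall\<close> into
    Hall's condition on cardinalities.\<close>
  define L where "L U = Sigma U (\<lambda>u. {..<m u})" for U :: "'v set"
  define A where "A l = L (exch_nbrs B p q {fst l})" for l :: "'v \<times> nat"
  have finL: "finite (L U)" for U by (simp add: L_def)
  have cardL: "int (card (L U)) = (\<Sum>u\<in>U. \<bar>q u - p u\<bar>)" for U
    by (simp add: L_def m_def)
  have "card J \<le> card (\<Union>(A ` J))" if J: "J \<subseteq> L UNIV" for J
  proof -
    \<comment> \<open>Adding all clones of the coordinates in \<open>J\<close> leaves the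
      neighbourhood unchanged.\<close>
    have "J \<subseteq> L (fst ` J)" using J by (force simp: L_def)
    then have "int (card J) \<le> int (card (L (fst ` J)))" by (simp add: card_mono finL)
    also have "\<dots> \<le> int (card (L (exch_nbrs B p q (fst ` J))))"
      unfolding cardL using J by (intro exch_nbrs_hall[OF E p q]) (auto simp: L_def m_def)
    also have "L (exch_nbrs B p q (fst ` J)) = \<Union>(A ` J)"
      by (auto simp: A_def L_def exch_nbrs_def)
    finally show ?thesis by simp
  qed
  then obtain R where R: "inj_on R (L UNIV)" "\<And>l. l \<in> L UNIV \<Longrightarrow> R l \<in> A l"
    using hall[of "L UNIV" A] finL by (metis A_def)
  have "R ` L UNIV \<subseteq> L UNIV" using R(2) by (force simp: A_def L_def)
  then have bij: "bij_betw R (L UNIV) (L UNIV)"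
    using R(1) finL by (simp add: bij_betw_def endo_inj_surj)
  have RA: "p (fst l) \<noteq> q (fst l)" "p (fst (R l)) \<noteq> q (fst (R l))"
    "(\<lambda>w. p w + toward p q (fst l) (fst (R l)) w) \<in> B" if "l \<in> L UNIV" for l
    using R(2)[OF that] that by (auto simp: A_def L_def m_def exch_nbrs_def)
  obtain ls where ls: "set ls = L UNIV" "distinct ls"
    using finite_distinct_list[OF finL] by blast
  \<comment> \<open>A matched pair contributes half a unit at both its ends; if the ends coincide this is a
    full unit, and since the single step appears with coefficient one half it is taken twice.\<close>
  define g where "g l = (let a = toward p q (fst l) (fst (R l)) in if fst l = fst (R l) then [a, a] else [a])" for l
  define as where "as = concat (map g ls)"
  have "set as \<subseteq> Phi_B B p q"
  proof
    fix a assume "a \<in> set as"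
    then obtain l where "l \<in> L UNIV" "a = toward p q (fst l) (fst (R l))"
      by (auto simp: as_def g_def ls Let_def simp del: split_paired_Ex split: if_splits)
    then show "a \<in> Phi_B B p q" using RA by (simp add: Phi_B_def toward_in_Phi_pq)
  qed
  moreover have "real_of_int (p u) + (\<Sum>a\<leftarrow>as. real_of_int (a u) / 2) = real_of_int (q u)" for u
  proof -
    \<comment> \<open>The share of one end of a matched pair. As \<open>R\<close> permutes the
      clones, each clone occurs once as a first end and once as a second, giving \<open>m u\<close>
      full units at \<open>u\<close>.\<close>
    define h where "h l = (if fst l = u then real_of_int (sgn (q u - p u)) / 2 else 0)" for l :: "'v \<times> nat"
    have "(\<Sum>a\<leftarrow>as. real_of_int (a u) / 2) = (\<Sum>l\<leftarrow>ls. \<Sum>a\<leftarrow>g l. real_of_int (a u) / 2)"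
      unfolding as_def by (induction ls) auto
    also have "\<dots> = (\<Sum>l\<leftarrow>ls. h l + h (R l))"
      by (rule arg_cong[where f = sum_list], rule map_cong) (auto simp: g_def h_def toward_def Let_def)
    also have "\<dots> = (\<Sum>l\<in>L UNIV. h l + h (R l))"
      using ls by (simp add: sum_list_distinct_conv_sum_set)
    also have "\<dots> = (\<Sum>l\<in>L UNIV. h l) + (\<Sum>l\<in>L UNIV. h (R l))" by (rule sum.distrib)
    also have "(\<Sum>l\<in>L UNIV. h (R l)) = (\<Sum>l\<in>L UNIV. h l)"
      by (rule sum.reindex_bij_betw[OF bij])
    also have "(\<Sum>l\<in>L UNIV. h l) = (\<Sum>v\<in>UNIV. \<Sum>i<m v. h (v, i))"
      unfolding L_def by (subst sum.Sigma) auto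
    also have "\<dots> = (\<Sum>v\<in>UNIV. if v = u then real (m u) * (real_of_int (sgn (q u - p u)) / 2) else 0)"
      by (rule sum.cong) (auto simp: h_def)
    also have "\<dots> = real (m u) * (real_of_int (sgn (q u - p u)) / 2)" by simp
    finally show ?thesis by (auto simp: m_def sgn_if)
  qed
  ultimately show "\<exists>as. set as \<subseteq> Phi_B B p q \<and>
      (\<forall>u. real_of_int (p u) + (\<Sum>a\<leftarrow>as. real_of_int (a u) / 2) = real_of_int (q u))" by blast
qed

text \<open>Steps that all vanish at \<open>u\<close> cannot produce a nonzero difference
  there.\<close>

lemma bs_exc_imp_delta_exc:
  fixes B :: "('v::finite \<Rightarrow> int) set"
  assumes "bs_exc B"
  shows "delta_exc B"
  unfolding delta_exc_def
proof (intro ballI)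
  fix p q u assume pq: "p \<in> B" "q \<in> B" and u: "u \<in> supp (\<lambda>v. q v - p v)"
  obtain as where as: "set as \<subseteq> Phi_B B p q"
    "real_of_int (p u) + (\<Sum>a\<leftarrow>as. real_of_int (a u) / 2) = real_of_int (q u)"
    using assms pq unfolding bs_exc_def by metis
  have "(\<Sum>a\<leftarrow>as. real_of_int (a u) / 2) \<noteq> 0" using as(2) u by (auto simp: supp_def)
  moreover have "(\<Sum>a\<leftarrow>as. real_of_int (a u) / 2) = (\<Sum>a\<leftarrow>as. 0)" if "\<forall>a\<in>set as. a u = 0"
    using that by (intro arg_cong[where f = sum_list] map_cong) auto
  ultimately have "\<exists>a\<in>set as. a u \<noteq> 0" by (metis sum_list_0)
  then show "\<exists>a\<in>Phi_B B p q. u \<in> supp a" using as(1) by (auto simp: supp_def)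
qed

theorem theorem1:
  fixes B :: "('v::finite \<Rightarrow> int) set"
  assumes "B \<noteq> {}"
  shows "(BS_convex B \<longleftrightarrow> delta_exc B) \<and> (delta_exc B \<longleftrightarrow> bs_exc B)"
proof -
  have "exchange B" if "BS_convex B"
    using that exchange_int_points_P unfolding BS_convex_def by blast
  then show ?thesis
    using exchange_imp_BS_convex[OF _ assms] exchange_imp_bs_exc[of B] bs_exc_imp_delta_exc[of B]
    unfolding delta_exc_iff_exchange by blast
qed

end
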